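(* For every odd integer $q\ge 5$, $$A(2/q)=\frac{1+\cos(\pi/q)}{q\cos(\pi/q)}.$$
   Context: For $0<h\le 1/2$, $K(h)$ denotes the class of continuous $1$-periodic even functions $f:\mathbb{R}\to\mathbb{R}$ such that: (1) $f(x)=\sum_{n=0}^{\infty}a_n\cos(2\pi nx)$; (2) $a_n\ge 0$ for all $n=0,1,2,\dots$; (3) $f(0)=\sum_{n=0}^{\infty}a_n=1$; (4) $f(x)=0$ for $h\le |x|\le 1/2$. Define $A(h)=\sup_{f\in K(h)}a_0=\sup_{f\in K(h)}\int_{-h}^{h}f(x)\,dx$. *)

theory Defs
  imports "HOL-Analysis.Analysis"
begin

definition cosine_coeffs :: "(real \<Rightarrow> real) \<Rightarrow> (nat \<Rightarrow> real) \<Rightarrow> bool" where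
  "cosine_coeffs f a \<longleftrightarrow>
     (\<forall>x. (\<lambda>n. a n * cos (2 * pi * real n * x)) sums f x) \<and> (\<forall>n. a n \<ge> 0) \<and> a sums 1"

definition K :: "real \<Rightarrow> (real \<Rightarrow> real) set" where
  "K h = {f. continuous_on UNIV f \<and> (\<forall>x. f (x + 1) = f x) \<and> (\<forall>x. f (- x) = f x) \<and>
             (\<exists>a. cosine_coeffs f a) \<and> f 0 = 1 \<and>
             (\<forall>x. h \<le> \<bar>x\<bar> \<and> \<bar>x\<bar> \<le> 1/2 \<longrightarrow> f x = 0)}"

text \<open>The coefficients are determined by the function; lemma \<open>A_eq_integral\<close> below shows that
  the supremum is also that of the integrals of \<open>f\<close> over \<open>[-h, h]\<close>.\<close>

definition A :: "real \<Rightarrow> real" where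
  "A h = Sup {a 0 | f a. f \<in> K h \<and> cosine_coeffs f a}"

lemma A_bdd_above: "bdd_above {a 0 | f a. f \<in> K h \<and> cosine_coeffs f a}"
proof -
  have "a 0 \<le> 1" if "cosine_coeffs f a" for f a
  proof -
    have "a sums 1" "\<And>n. 0 \<le> a n" using that by (auto simp: cosine_coeffs_def)
    then show ?thesis using sum_le_suminf[of a "{0}"] by (simp add: sums_iff)
  qed
  then show ?thesis by (auto intro!: bdd_aboveI[of _ 1])
qed

lemma integral_cos_period:
  assumes "n > 0"
  shows "((\<lambda>x. cos (2 * pi * real n * x)) has_integral 0) {-1/2..1/2}"
proof -
  let ?c = "2 * pi * real n"
  have c: "?c \<noteq> 0" using assms by simp
  have "((\<lambda>x. sin (?c * x) / ?c) has_real_derivative cos (?c * x)) (at x within {-1/2..1/2})" for x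
    using c by (auto intro!: derivative_eq_intros)
  then have "((\<lambda>x. cos (?c * x)) has_integral
     (sin (?c * (1/2)) / ?c - sin (?c * (-1/2)) / ?c)) {-1/2..1/2}"
    by (intro fundamental_theorem_of_calculus) (auto simp: has_real_derivative_iff_has_vector_derivative)
  moreover have "?c * (1/2) = real n * pi" "?c * (-1/2) = - (real n * pi)" by simp_all
  ultimately show ?thesis by (simp only: sin_minus sin_npi) simp
qed

lemma cosine_coeffs_integral:
  assumes "cosine_coeffs f a"
  shows "(f has_integral a 0) {-1/2..1/2}"
proof -
  let ?S = "\<lambda>N x. \<Sum>n<N. a n * cos (2 * pi * real n * x)"
  have a: "a sums 1" "\<And>n. 0 \<le> a n" and f: "f = (\<lambda>x. \<Sum>n. a n * cos (2 * pi * real n * x))"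
    using assms by (auto simp: cosine_coeffs_def sums_iff)
  have u: "uniform_limit {-1/2..1/2} ?S f sequentially"
    unfolding f
  proof (rule Weierstrass_m_test)
    show "norm (a n * cos (2 * pi * real n * x)) \<le> a n" for n x
      using a(2)[of n] by (simp add: abs_mult mult_left_le)
    show "summable a" using a(1) by (simp add: sums_iff)
  qed
  have S: "(?S N has_integral (\<Sum>n<N. if n = 0 then a 0 else 0)) {-1/2..1/2}" for N
  proof (intro has_integral_sum)
    fix n
    show "((\<lambda>x. a n * cos (2 * pi * real n * x)) has_integral (if n = 0 then a 0 else 0)) {-1/2..1/2}"
    proof (cases "n = 0")
      case True
      then show ?thesis using has_integral_const_real[of "a 0" "-1/2" "1/2"] by simp
    next
      case False
      then have "((\<lambda>x. a n * cos (2 * pi * real n * x)) has_integral a n * 0) {-1/2..1/2}"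
        by (intro has_integral_mult_right integral_cos_period) simp
      then show ?thesis using False by simp
    qed
  qed auto
  have c: "continuous_on {-1/2..1/2} (?S N)" for N by (intro continuous_intros)
  obtain I J where IJ: "\<And>N. (?S N has_integral I N) {-1/2..1/2}"
      "(f has_integral J) {-1/2..1/2}" "(I \<longlongrightarrow> J) sequentially"
    using uniform_limit_integral[OF u c sequentially_bot] by blast
  have "I N = a 0" if "N > 0" for N
    using has_integral_unique[OF IJ(1)[of N] S[of N]] that by simp
  then have "(I \<longlongrightarrow> a 0) sequentially"
    by (intro tendsto_eventually eventually_sequentiallyI[of 1]) auto
  then show ?thesis using IJ LIMSEQ_unique by blast
qed

lemma K_integral:
  assumes "f \<in> K h" "cosine_coeffs f a" "0 < h" "h \<le> 1/2"
  shows "integral {-h..h} f = a 0"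
proof -
  have "(f has_integral a 0) {-1/2..1/2}" by (rule cosine_coeffs_integral[OF assms(2)])
  moreover have "{x \<in> {-h..h} - {-1/2..1/2}. f x \<noteq> 0} = {}" using assms(4) by auto
  moreover have "{x \<in> {-1/2..1/2} - {-h..h}. f x \<noteq> 0} = {}"
  proof -
    have "f x = 0" if "x \<in> {-1/2..1/2} - {-h..h}" for x
    proof -
      have "h \<le> \<bar>x\<bar> \<and> \<bar>x\<bar> \<le> 1/2" using that by auto
      then show ?thesis using assms(1) unfolding K_def by blast
    qed
    then show ?thesis by blast
  qed
  ultimately have "(f has_integral a 0) {-h..h}"
    using has_integral_spike_set_eq[of "{-h..h}" "{-1/2..1/2}" f "a 0"]
    by (simp only: negligible_empty simp_thms)
  then show ?thesis by (rule integral_unique)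
qed

lemma A_eq_integral:
  assumes "0 < h" "h \<le> 1/2"
  shows "A h = (SUP f\<in>K h. integral {-h..h} f)"
proof -
  have "{a 0 | f a. f \<in> K h \<and> cosine_coeffs f a} = (\<lambda>f. integral {-h..h} f) ` K h"
  proof (intro equalityI subsetI)
    fix y assume "y \<in> {a 0 | f a. f \<in> K h \<and> cosine_coeffs f a}"
    then obtain f a where "y = a 0" "f \<in> K h" "cosine_coeffs f a" by blast
    then show "y \<in> (\<lambda>f. integral {-h..h} f) ` K h"
      using K_integral[of f h a] assms by (intro image_eqI[of _ _ f]) simp_all
  next
    fix y assume "y \<in> (\<lambda>f. integral {-h..h} f) ` K h"
    then obtain f where y: "y = integral {-h..h} f" and f: "f \<in> K h" by blast
    then obtain a where a: "cosine_coeffs f a" unfolding K_def by blast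
    have "y = a 0" using K_integral[OF f a assms] y by simp
    then show "y \<in> {a 0 | f a. f \<in> K h \<and> cosine_coeffs f a}" using f a by blast
  qed
  then show ?thesis by (simp add: A_def)
qed

end

theory Submission imports Defs begin

text \<open>Put $w = 1/q$ and $c = \cos(\pi/q)$. A member \<open>f\<close> of \<open>K (2 w)\<close> is known on the grid of the
  multiples of \<open>w\<close>, up to one number: modulo $1$ the only grid points where it need not vanish are
  $0$ and $\pm w$, with values $1$ and $t = f(w)$. Its discrete cosine transform on the grid is
  therefore $1 + 2 t \cos(2 \pi j / q)$. The characters of the grid are orthogonal, so this transform
  collects coefficients $a_n$ with nonnegative weights. Hence it is nonnegative for every $j$, and
  for $j = 0$ it is at least $q a_0$. For odd \<open>q\<close> the smallest value of $\cos(2 \pi j / q)$ is $-c$,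
  attained at $j = (q - 1)/2$, so that $2 t \le 1 / c$ and
  $q a_0 \le 1 + 2 t \le 1 + 1/c$; this is \<open>K_coeff_0_le\<close>.

  Equality forces the coefficients to vanish at the nonzero multiples of \<open>q\<close> and at
  $n \equiv \pm (q - 1)/2$ modulo \<open>q\<close>. Both sets of zeros appear in
  $(\sin(\pi n/q) / (\pi n/q))^2 \, (c + \cos(2 \pi n/q))$. The first factor belongs to the
  tent function \<open>g\<close> of half width \<open>w\<close>, and the second is the effect of translations by $\pm w$.
  So the extremal function is $f(x) = g(x) + (g(x - w) + g(x + w)) / (2 c)$, which is supported
  in $[-2w, 2w]$ modulo $1$. Its coefficients are nonnegative by \<open>cos_grid_ge\<close>, even though the
  factor $c + \cos(2 \pi \xi)$ takes negative values at some real $\xi$ between the points $n/q$.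

  The one analytic ingredient is the cosine expansion of the tent. By
  \<open>cosine_series_eq_on_half_period\<close>, an absolutely convergent cosine series with the right
  coefficients does converge to the function, because a continuous function
  orthogonal to all cosines is zero.\<close>

section \<open>Cosine series on a half period\<close>

lemma has_integral_cos_half_period:
  fixes k :: int
  shows "((\<lambda>x. cos (2 * pi * k * x)) has_integral (if k = 0 then 1/2 else 0)) {0..1/2}"
proof (cases "k = 0")
  case True
  then show ?thesis using has_integral_const_real[of "1::real" 0 "1/2"] by simp
next
  case False
  let ?c = "2 * pi * real_of_int k"
  have c: "?c \<noteq> 0" using False by simp
  have "((\<lambda>x. sin (?c * x) / ?c) has_real_derivative cos (?c * x)) (at x within {0..1/2})" for x
    using c by (auto intro!: derivative_eq_intros)
  then have "((\<lambda>x. cos (?c * x)) has_integral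
     (sin (?c * (1/2)) / ?c - sin (?c * 0) / ?c)) {0..1/2}"
    by (intro fundamental_theorem_of_calculus) (auto simp: has_real_derivative_iff_has_vector_derivative)
  moreover have "?c * (1/2) = pi * of_int k" by simp
  ultimately show ?thesis using False sin_zero_iff_int2[of "pi * of_int k"] by auto
qed

lemma has_integral_cos_mult_cos:
  fixes m n :: nat
  shows "((\<lambda>x. cos (2 * pi * real n * x) * cos (2 * pi * real m * x)) has_integral
    (if n = m then (if m = 0 then 1/2 else 1/4) else 0)) {0..1/2}"
proof -
  have "((\<lambda>x. (cos (2 * pi * (int n - int m) * x) + cos (2 * pi * (int n + int m) * x)) / 2)
      has_integral ((if int n - int m = 0 then 1/2 else 0) + (if int n + int m = 0 then 1/2 else 0)) / 2)
      {0..1/2}"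
    by (intro has_integral_divide has_integral_add has_integral_cos_half_period)
  moreover have "(cos (2 * pi * (int n - int m) * x) + cos (2 * pi * (int n + int m) * x)) / 2
      = cos (2 * pi * real n * x) * cos (2 * pi * real m * x)" for x
  proof -
    have "2 * pi * (int n - int m) * x = 2 * pi * real n * x - 2 * pi * real m * x"
      "2 * pi * (int n + int m) * x = 2 * pi * real n * x + 2 * pi * real m * x"
      by (simp_all add: algebra_simps)
    then show ?thesis by (simp only: cos_times_cos)
  qed
  moreover have "((if int n - int m = 0 then 1/2 else 0) + (if int n + int m = 0 then 1/2 else 0)) / 2
      = (if n = m then (if m = 0 then 1/2 else 1/4) else 0 :: real)" by auto
  ultimately show ?thesis by (simp only:)
qed

text \<open>The substitution $y = \cos(2 \pi x)$ maps the half period bijectively onto $[-1, 1]$ and turns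
  \<open>u\<close> into a continuous function \<open>v\<close>. The powers of $\cos(2 \pi x)$ are combinations of the cosines,
  so \<open>u\<close> is orthogonal to every polynomial in \<open>y\<close>. Polynomials approximate \<open>v\<close>
  uniformly, so \<open>u\<close> is orthogonal to itself.\<close>

lemma eq_0_if_orthogonal_to_cosines:
  fixes u :: "real \<Rightarrow> real"
  assumes u: "continuous_on {0..1/2} u"
    and orth: "\<And>n. ((\<lambda>x. u x * cos (2 * pi * real n * x)) has_integral 0) {0..1/2}"
    and x: "x \<in> {0..1/2}"
  shows "u x = 0"
proof -
  let ?I = "{0..1/2::real}"
  have cospow: "((\<lambda>x. u x * cos (2 * pi * real n * x) * cos (2 * pi * x) ^ k) has_integral 0) ?I" for n k
  proof (induction k arbitrary: n)
    case 0
    then show ?case using orth by simp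
  next
    case (Suc k)
    \<comment> \<open>One factor $\cos(2 \pi x)$ shifts the frequency by $\pm 1$; for $n = 0$ the shift to $-1$
      is, by evenness, the frequency $1$.\<close>
    have "((\<lambda>x. (u x * cos (2 * pi * real (n + 1) * x) * cos (2 * pi * x) ^ k
        + u x * cos (2 * pi * real (if n = 0 then 1 else n - 1) * x) * cos (2 * pi * x) ^ k) / 2)
        has_integral (0 + 0) / 2) ?I"
      by (intro has_integral_divide has_integral_add Suc.IH)
    moreover have "(u x * cos (2 * pi * real (n + 1) * x) * cos (2 * pi * x) ^ k
        + u x * cos (2 * pi * real (if n = 0 then 1 else n - 1) * x) * cos (2 * pi * x) ^ k) / 2
        = u x * cos (2 * pi * real n * x) * cos (2 * pi * x) ^ Suc k" for x
    proof (cases n)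
      case (Suc l)
      have "cos (2 * pi * real (n + 1) * x) = cos (2 * pi * real n * x + 2 * pi * x)"
           "cos (2 * pi * real l * x) = cos (2 * pi * real n * x - 2 * pi * x)"
        using Suc by (simp_all add: algebra_simps)
      then have "cos (2 * pi * real (n + 1) * x) + cos (2 * pi * real l * x)
          = 2 * (cos (2 * pi * real n * x) * cos (2 * pi * x))"
        by (simp only: cos_add cos_diff)
      moreover have "(u x * p * c + u x * r * c) / 2 = u x * s * (d * c)" if "p + r = 2 * (s * d)"
        for p r s c d :: real
      proof -
        have "u x * p * c + u x * r * c = u x * (p + r) * c" by (simp add: algebra_simps)
        then show ?thesis using that by simp
      qed
      ultimately show ?thesis unfolding Suc power_Suc by simp
    qed simp
    ultimately show ?case by (simp only: add_0 div_0)
  qed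
  have poly: "((\<lambda>x. u x * g (cos (2 * pi * x))) has_integral 0) ?I" if g: "real_polynomial_function g" for g
  proof -
    obtain a N where g: "g = (\<lambda>x. \<Sum>i\<le>N. a i * x ^ i)"
      using g unfolding real_polynomial_function_iff_sum by blast
    have "((\<lambda>x. \<Sum>i\<le>N. a i * (u x * cos (2 * pi * real 0 * x) * cos (2 * pi * x) ^ i)) has_integral
        (\<Sum>i\<le>N. a i * 0)) ?I"
      by (intro has_integral_sum has_integral_mult_right cospow) auto
    then show ?thesis by (simp add: g sum_distrib_left mult.left_commute)
  qed
  define v where "v y = u (arccos y / (2 * pi))" for y
  have "continuous_on {-1..1} v"
  proof -
    have "(\<lambda>y. arccos y / (2 * pi)) ` {-1..1} \<subseteq> ?I"
      using arccos_lbound arccos_ubound by (auto simp: field_simps)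
    moreover have "continuous_on {-1..1} (\<lambda>y. arccos y / (2 * pi))"
      by (intro continuous_intros) auto
    ultimately show ?thesis unfolding v_def
      using continuous_on_compose2[OF u] by blast
  qed
  have v: "v (cos (2 * pi * x)) = u x" if "x \<in> ?I" for x
    using that by (simp add: v_def arccos_cos)
  have sq: "(\<lambda>x. u x * u x) integrable_on ?I"
    by (intro integrable_continuous_real continuous_intros u)
  have "compact (u ` ?I)" by (intro compact_continuous_image u) simp
  then obtain B where B: "B > 0" "\<And>x. x \<in> ?I \<Longrightarrow> \<bar>u x\<bar> \<le> B"
    using compact_imp_bounded[of "u ` ?I"] unfolding bounded_pos by auto
  have small: "integral ?I (\<lambda>x. u x * u x) \<le> e" if "e > 0" for e
  proof -
    obtain g where g: "real_polynomial_function g" "\<And>y. y \<in> {-1..1} \<Longrightarrow> \<bar>v y - g y\<bar> < e / B"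
      using Stone_Weierstrass_real_polynomial_function[of "{-1..1}" v "e / B"]
        \<open>continuous_on {-1..1} v\<close> B(1) \<open>e > 0\<close> by auto
    have "((\<lambda>x. u x * u x - u x * g (cos (2 * pi * x))) has_integral integral ?I (\<lambda>x. u x * u x) - 0) ?I"
      using sq poly[OF g(1)] by (intro has_integral_diff integrable_integral)
    moreover have "((\<lambda>x. e) has_integral e / 2) ?I"
      using has_integral_const_real[of e 0 "1/2"] by simp
    moreover have "u x * u x - u x * g (cos (2 * pi * x)) \<le> e" if "x \<in> ?I" for x
    proof -
      have "\<bar>u x - g (cos (2 * pi * x))\<bar> \<le> e / B"
        using g(2)[of "cos (2 * pi * x)"] v[OF that] by simp
      then have "\<bar>u x\<bar> * \<bar>u x - g (cos (2 * pi * x))\<bar> \<le> B * (e / B)"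
        using B that by (intro mult_mono) auto
      then have "\<bar>u x * (u x - g (cos (2 * pi * x)))\<bar> \<le> e" using B by (simp add: abs_mult)
      then show ?thesis by (simp add: algebra_simps)
    qed
    ultimately have "integral ?I (\<lambda>x. u x * u x) - 0 \<le> e / 2" by (rule has_integral_le)
    then show ?thesis using \<open>e > 0\<close> by simp
  qed
  have "integral ?I (\<lambda>x. u x * u x) \<le> 0" by (rule field_le_epsilon) (use small in simp)
  then have "integral ?I (\<lambda>x. u x * u x) = 0"
    using integral_nonneg[OF sq] by force
  then have "\<forall>x\<in>?I. u x * u x = 0"
    using u by (subst (asm) integral_eq_0_iff) (auto intro!: continuous_intros)
  then show ?thesis using x by simp
qed

text \<open>The bounded factor \<open>b\<close> serves for both uses: $b = 1$ gives continuity of the sum, and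
  $b(x) = \cos(2 \pi m x)$ allows the coefficients of the sum to be found term by term.\<close>

lemma cosine_series_uniform_limit:
  assumes t: "summable (\<lambda>n. \<bar>t n\<bar>)" and b: "\<And>x. \<bar>b x\<bar> \<le> (1::real)"
  shows "uniform_limit S (\<lambda>N x. \<Sum>n<N. t n * cos (2 * pi * real n * x) * b x)
    (\<lambda>x. \<Sum>n. t n * cos (2 * pi * real n * x) * b x) sequentially"
proof (rule Weierstrass_m_test[OF _ t])
  fix n and x :: real
  have "\<bar>t n\<bar> * \<bar>cos (2 * pi * real n * x)\<bar> * \<bar>b x\<bar> \<le> \<bar>t n\<bar> * 1 * 1"
    using b by (intro mult_mono) auto
  then show "norm (t n * cos (2 * pi * real n * x) * b x) \<le> \<bar>t n\<bar>" by (simp add: abs_mult)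
qed

lemma summable_cosine_series:
  assumes "summable (\<lambda>n. \<bar>t n\<bar>)"
  shows "summable (\<lambda>n. t n * cos (2 * pi * real n * x))"
proof (rule summable_comparison_test'[OF assms])
  fix n
  show "norm (t n * cos (2 * pi * real n * x)) \<le> \<bar>t n\<bar>"
    by (simp add: abs_mult mult_left_le)
qed

lemma continuous_on_cosine_series:
  assumes "summable (\<lambda>n. \<bar>t n\<bar>)"
  shows "continuous_on S (\<lambda>x. \<Sum>n. t n * cos (2 * pi * real n * x))"
  by (rule uniform_limit_theorem[OF _ cosine_series_uniform_limit[OF assms, of "\<lambda>_. 1", simplified]])
     (auto intro!: always_eventually continuous_intros)

text \<open>Uniform convergence makes the coefficients of the sum computable term by term; they agree with
  those of \<open>F\<close>, so the difference is orthogonal to all cosines. Only values on the half period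
  enter, which spares any periodic or even extension of \<open>F\<close>.\<close>

lemma cosine_series_eq_on_half_period:
  assumes F: "continuous_on {0..1/2} F" and t: "summable (\<lambda>n. \<bar>t n\<bar>)"
    and coeff: "\<And>n. ((\<lambda>x. F x * cos (2 * pi * real n * x)) has_integral
                    t n * (if n = 0 then 1/2 else 1/4)) {0..1/2}"
    and x: "x \<in> {0..1/2}"
  shows "(\<Sum>n. t n * cos (2 * pi * real n * x)) = F x"
proof -
  let ?I = "{0..1/2::real}" and ?g = "\<lambda>x. \<Sum>n. t n * cos (2 * pi * real n * x)"
  have "((\<lambda>x. ?g x * cos (2 * pi * real m * x)) has_integral t m * (if m = 0 then 1/2 else 1/4)) ?I" for m
  proof -
    let ?S = "\<lambda>N x. \<Sum>n<N. t n * cos (2 * pi * real n * x) * cos (2 * pi * real m * x)"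
    have S: "(?S N has_integral
        (\<Sum>n<N. t n * (if n = m then (if m = 0 then 1/2 else 1/4) else 0))) ?I" for N
      unfolding mult.assoc[of "t _"]
      by (intro has_integral_sum has_integral_mult_right has_integral_cos_mult_cos) auto
    have c: "continuous_on ?I (?S N)" for N by (intro continuous_intros)
    obtain I J where IJ: "\<And>N. (?S N has_integral I N) ?I"
       "((\<lambda>x. \<Sum>n. t n * cos (2 * pi * real n * x) * cos (2 * pi * real m * x)) has_integral J) ?I"
       "(I \<longlongrightarrow> J) sequentially"
      using uniform_limit_integral[OF cosine_series_uniform_limit[OF t] c sequentially_bot]
      by (smt (verit) abs_cos_le_one)
    have "I N = t m * (if m = 0 then 1/2 else 1/4)" if "N > m" for N
      using has_integral_unique[OF IJ(1)[of N] S[of N]] that by (simp add: if_distrib sum.delta cong: if_cong)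
    then have "(I \<longlongrightarrow> t m * (if m = 0 then 1/2 else 1/4)) sequentially"
      by (intro tendsto_eventually eventually_sequentiallyI[of "Suc m"]) auto
    then have "J = t m * (if m = 0 then 1/2 else 1/4)" using IJ(3) LIMSEQ_unique by blast
    then show ?thesis using IJ(2) by (simp add: suminf_mult2[OF summable_cosine_series[OF t]])
  qed
  note g_coeff = this
  have orth: "((\<lambda>x. (?g x - F x) * cos (2 * pi * real n * x)) has_integral 0) ?I" for n
    using has_integral_diff[OF g_coeff[of n] coeff[of n]] by (simp only: left_diff_distrib diff_self)
  have "?g x - F x = 0"
    by (rule eq_0_if_orthogonal_to_cosines[OF _ orth x])
       (intro continuous_intros continuous_on_cosine_series t F)
  then show ?thesis by simp
qed

section \<open>The periodized tent\<close>

text \<open>For $n \ge 1$ this is $2 w (\sin(\pi n w) / (\pi n w))^2$, written without squares of sines.\<close>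

definition tent_coeff :: "real \<Rightarrow> nat \<Rightarrow> real" where
  "tent_coeff w n = (if n = 0 then w else (1 - cos (2 * pi * real n * w)) / (w * pi\<^sup>2 * (real n)\<^sup>2))"

text \<open>The function is introduced by its series, so that periodicity and evenness come for free; that
  it is the tent $\max(0, 1 - |x|/w)$ on $[-1/2, 1/2]$ follows from the expansion.\<close>

definition periodic_tent :: "real \<Rightarrow> real \<Rightarrow> real" where
  "periodic_tent w x = (\<Sum>n. tent_coeff w n * cos (2 * pi * real n * x))"

lemma tent_coeff_nonneg: "w > 0 \<Longrightarrow> tent_coeff w n \<ge> 0"
  by (auto simp: tent_coeff_def intro!: divide_nonneg_nonneg)

lemma summable_tent_coeff:
  assumes "w > 0"
  shows "summable (\<lambda>n. \<bar>tent_coeff w n\<bar>)"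
proof (rule summable_comparison_test')
  show "summable (\<lambda>n. 2 / (w * pi\<^sup>2) * inverse (real n ^ 2))"
    by (intro summable_mult inverse_power_summable) simp
  fix n :: nat assume "n \<ge> 1"
  have "(1 - cos (2 * pi * real n * w)) / (w * pi\<^sup>2 * (real n)\<^sup>2) \<le> 2 / (w * pi\<^sup>2 * (real n)\<^sup>2)"
    using assms cos_ge_minus_one[of "2 * pi * real n * w"] by (intro divide_right_mono) auto
  then show "norm \<bar>tent_coeff w n\<bar> \<le> 2 / (w * pi\<^sup>2) * inverse (real n ^ 2)"
    using \<open>n \<ge> 1\<close> tent_coeff_nonneg[OF assms, of n] by (simp add: tent_coeff_def field_simps)
qed

lemma tent_has_integral_cos:
  assumes "0 < w" "w \<le> 1/2"
  shows "((\<lambda>x. max 0 (1 - x / w) * cos (2 * pi * real n * x)) has_integral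
    tent_coeff w n * (if n = 0 then 1/2 else 1/4)) {0..1/2}"
proof -
  let ?v = "tent_coeff w n * (if n = 0 then 1/2 else 1/4)"
  define b where "b = 2 * pi * real n"
  \<comment> \<open>An antiderivative on the support $[0, w]$, where the tent is $1 - x/w$.\<close>
  define P where "P x = (if n = 0 then x - x\<^sup>2 / (2 * w)
      else (1 - x / w) * sin (b * x) / b - cos (b * x) / (w * b\<^sup>2))" for x
  have b: "b \<noteq> 0" if "n \<noteq> 0" using that by (simp add: b_def)
  have "(P has_real_derivative (1 - x / w) * cos (b * x)) (at x within {0..w})" for x
  proof (cases "n = 0")
    case True
    then show ?thesis unfolding P_def b_def using assms
      by (auto intro!: derivative_eq_intros simp: field_simps)
  next
    case False
    then show ?thesis using b assms unfolding P_def
      by (auto intro!: derivative_eq_intros simp: field_simps power2_eq_square)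
  qed
  then have "((\<lambda>x. (1 - x / w) * cos (b * x)) has_integral P w - P 0) {0..w}"
    using assms by (intro fundamental_theorem_of_calculus)
       (auto simp: has_real_derivative_iff_has_vector_derivative)
  moreover have "P w - P 0 = ?v"
  proof (cases "n = 0")
    case True
    then show ?thesis using assms by (simp add: P_def tent_coeff_def power2_eq_square)
  next
    case False
    then show ?thesis using assms
      by (simp add: P_def tent_coeff_def b_def power2_eq_square field_simps)
  qed
  ultimately have "((\<lambda>x. (1 - x / w) * cos (b * x)) has_integral ?v) {0..w}" by simp
  then have 1: "((\<lambda>x. max 0 (1 - x / w) * cos (b * x)) has_integral ?v) {0..w}"
    by (rule has_integral_eq[rotated]) (use assms in \<open>auto simp: max_def field_simps\<close>)
  have 2: "((\<lambda>x. max 0 (1 - x / w) * cos (b * x)) has_integral 0) {w..1/2}"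
    by (rule has_integral_eq[OF _ has_integral_0]) (use assms in \<open>auto simp: max_def field_simps\<close>)
  show ?thesis using has_integral_combine[OF _ _ 1 2] assms by (simp add: b_def)
qed

lemma periodic_tent_sums:
  assumes "w > 0"
  shows "(\<lambda>n. tent_coeff w n * cos (2 * pi * real n * x)) sums periodic_tent w x"
  unfolding periodic_tent_def
  by (intro summable_sums summable_cosine_series summable_tent_coeff assms)

lemma continuous_on_periodic_tent: "w > 0 \<Longrightarrow> continuous_on S (periodic_tent w)"
  unfolding periodic_tent_def[abs_def]
  by (intro continuous_on_cosine_series summable_tent_coeff)

lemma periodic_tent_minus: "periodic_tent w (- x) = periodic_tent w x"
  by (simp add: periodic_tent_def)

lemma cos_shift_period: "cos (2 * pi * real n * (x + 1)) = cos (2 * pi * real n * x)"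
proof -
  have "2 * pi * real n * (x + 1) = 2 * pi * real n * x + 2 * real n * pi" by (simp add: algebra_simps)
  then show ?thesis by (simp only: cos_add) simp
qed

lemma periodic_tent_plus1: "periodic_tent w (x + 1) = periodic_tent w x"
  by (simp only: periodic_tent_def cos_shift_period)

lemma periodic_tent_eq:
  assumes "0 < w" "w \<le> 1/2" "x \<in> {0..1/2}"
  shows "periodic_tent w x = max 0 (1 - x / w)"
  unfolding periodic_tent_def
  by (rule cosine_series_eq_on_half_period[OF _ summable_tent_coeff tent_has_integral_cos])
     (use assms in \<open>auto intro!: continuous_intros\<close>)

lemma periodic_tent_eq_0:
  assumes "0 < w" "w \<le> x" "x \<le> 1 - w"
  shows "periodic_tent w x = 0"
proof (cases "x \<le> 1/2")
  case True
  then show ?thesis using assms by (simp add: periodic_tent_eq max_def field_simps)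
next
  case False
  have "periodic_tent w x = periodic_tent w (1 - x)"
    using periodic_tent_plus1[of w "- x"] by (simp add: periodic_tent_minus add.commute)
  also have "\<dots> = 0" using False assms by (simp add: periodic_tent_eq max_def field_simps)
  finally show ?thesis .
qed

section \<open>The extremal function\<close>

text \<open>For odd \<open>q\<close> the angles $2 \pi n / q$ miss $\pi$, and those nearest to it modulo $2\pi$ are at
  distance $\pi / q$.\<close>

lemma cos_grid_ge:
  fixes n q :: nat
  assumes "odd q"
  shows "cos (2 * pi * real n / real q) \<ge> - cos (pi / real q)"
proof -
  define r where "r = n mod q"
  have q: "q > 0" using assms by (cases q) auto
  have r: "r < q" using q by (simp add: r_def)
  have "real n = real q * real (n div q) + real r"
    by (metis mult_div_mod_eq of_nat_add of_nat_mult r_def)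
  then have "2 * pi * real n / real q = 2 * pi * real r / real q + 2 * real (n div q) * pi"
    using q by (simp add: field_simps)
  then have n: "cos (2 * pi * real n / real q) = cos (2 * pi * real r / real q)"
    by (simp only: cos_add) simp
  have half: "cos (2 * pi * real s / real q) \<ge> - cos (pi / real q)" if "2 * s < q" for s :: nat
  proof -
    have "2 * real s + 1 \<le> real q" using that by linarith
    then have "pi * (2 * real s + 1) \<le> pi * real q" by (intro mult_left_mono) auto
    then have "2 * pi * real s / real q \<le> pi - pi / real q" using q by (simp add: field_simps)
    then have "cos (pi - pi / real q) \<le> cos (2 * pi * real s / real q)"
      using q by (intro cos_monotone_0_pi_le) auto
    then show ?thesis by simp
  qed
  show ?thesis
  proof (cases "2 * r < q")
    case True
    then show ?thesis using half n by simp
  next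
    case False
    then have "2 * (q - r) < q" using assms r by (cases "2 * r = q") auto
    moreover have "2 * pi * real (q - r) / real q = 2 * pi - 2 * pi * real r / real q"
      using r q by (simp add: of_nat_diff field_simps)
    ultimately show ?thesis using half[of "q - r"] n by (simp add: cos_diff)
  qed
qed

text \<open>A translation by $\pm 1/q$, averaged over both signs, multiplies the $n$th cosine coefficient by
  $\cos(2 \pi n / q)$.\<close>

definition extremal_coeff :: "nat \<Rightarrow> nat \<Rightarrow> real" where
  "extremal_coeff q n = tent_coeff (1 / q) n * (1 + cos (2 * pi * real n / q) / cos (pi / q))"

definition extremal_fun :: "nat \<Rightarrow> real \<Rightarrow> real" where
  "extremal_fun q x = periodic_tent (1 / q) x +
     (periodic_tent (1 / q) (x + 1 / q) + periodic_tent (1 / q) (x - 1 / q)) / (2 * cos (pi / q))"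

lemma cos_pi_div_pos: "q > 2 \<Longrightarrow> cos (pi / real q) > 0"
  by (intro cos_gt_zero_pi) (auto simp: field_simps intro: less_le_trans[of _ 0])

lemma extremal_fun_sums:
  assumes "q > 2"
  shows "(\<lambda>n. extremal_coeff q n * cos (2 * pi * real n * x)) sums extremal_fun q x"
proof -
  let ?t = "tent_coeff (1 / q)" and ?c = "cos (pi / q)"
  have w: "1 / real q > 0" and c: "?c > 0" using assms cos_pi_div_pos by auto
  have "(\<lambda>n. ?t n * cos (2 * pi * real n * x) +
      (?t n * cos (2 * pi * real n * (x + 1 / q)) + ?t n * cos (2 * pi * real n * (x - 1 / q))) / (2 * ?c))
      sums extremal_fun q x"
    unfolding extremal_fun_def by (intro sums_add sums_divide periodic_tent_sums w)
  moreover have "?t n * cos (2 * pi * real n * x) +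
      (?t n * cos (2 * pi * real n * (x + 1 / q)) + ?t n * cos (2 * pi * real n * (x - 1 / q))) / (2 * ?c)
      = extremal_coeff q n * cos (2 * pi * real n * x)" for n
  proof -
    have "2 * pi * real n * (x + 1 / q) = 2 * pi * real n * x + 2 * pi * real n / q"
      "2 * pi * real n * (x - 1 / q) = 2 * pi * real n * x - 2 * pi * real n / q"
      by (simp_all add: algebra_simps)
    then show ?thesis using c
      by (simp only: cos_add cos_diff extremal_coeff_def) (simp add: field_simps)
  qed
  ultimately show ?thesis by simp
qed

lemma extremal_coeff_nonneg:
  assumes "odd q" "q > 2"
  shows "extremal_coeff q n \<ge> 0"
proof -
  have "1 + cos (2 * pi * real n / q) / cos (pi / q) \<ge> 0"
    using cos_grid_ge[OF assms(1), of n] cos_pi_div_pos[OF assms(2)] by (simp add: field_simps)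
  then show ?thesis using assms(2) by (simp add: extremal_coeff_def tent_coeff_nonneg)
qed

lemma extremal_fun_0:
  assumes "q > 2"
  shows "extremal_fun q 0 = 1"
  using assms by (simp add: extremal_fun_def periodic_tent_minus periodic_tent_eq periodic_tent_eq_0 field_simps)

lemma extremal_fun_minus: "extremal_fun q (- x) = extremal_fun q x"
  using periodic_tent_minus[of "1 / q" "x + 1 / q"] periodic_tent_minus[of "1 / q" "x - 1 / q"]
  by (simp add: extremal_fun_def periodic_tent_minus add.commute)

lemma extremal_fun_plus1: "extremal_fun q (x + 1) = extremal_fun q x"
  using periodic_tent_plus1[of "1 / q" "x + 1 / q"] periodic_tent_plus1[of "1 / q" "x - 1 / q"]
    periodic_tent_plus1[of "1 / q" x]
  by (simp add: extremal_fun_def algebra_simps)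

text \<open>For $2/q \le x \le 1/2$ the three points $x$ and $x \pm 1/q$ all lie in $[1/q, 1 - 1/q]$,
  where the tent vanishes; at the upper end this is $1/2 + 1/q \le 1 - 1/q$, that is
  $q \ge 4$.\<close>

lemma extremal_fun_eq_0:
  assumes "q \<ge> 4" "2 / real q \<le> \<bar>x\<bar>" "\<bar>x\<bar> \<le> 1/2"
  shows "extremal_fun q x = 0"
proof -
  have "extremal_fun q x = extremal_fun q \<bar>x\<bar>" by (simp add: abs_if extremal_fun_minus)
  also have "\<dots> = 0"
  proof -
    have "1 / real q \<le> 1/4" using assms by (simp add: field_simps)
    then show ?thesis using assms unfolding extremal_fun_def
      by (subst (1 2 3) periodic_tent_eq_0) auto
  qed
  finally show ?thesis .
qed

lemma extremal_fun_in_K: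
  assumes "odd q" "q \<ge> 4"
  shows "cosine_coeffs (extremal_fun q) (extremal_coeff q)" "extremal_fun q \<in> K (2 / q)"
proof -
  have q: "q > 2" using assms by simp
  show *: "cosine_coeffs (extremal_fun q) (extremal_coeff q)"
    using extremal_fun_sums[OF q] extremal_fun_sums[OF q, of 0] extremal_coeff_nonneg[OF assms(1) q]
    by (simp add: cosine_coeffs_def extremal_fun_0[OF q])
  have w: "1 / real q > 0" using q by simp
  have "continuous_on UNIV (extremal_fun q)"
    unfolding extremal_fun_def[abs_def]
    using q cos_pi_div_pos[OF q]
    by (intro continuous_intros continuous_on_compose2[OF continuous_on_periodic_tent[OF w, of UNIV]]) auto
  then show "extremal_fun q \<in> K (2 / q)"
    using * extremal_fun_0[OF q] extremal_fun_eq_0[OF assms(2)]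
    by (auto simp: K_def extremal_fun_minus extremal_fun_plus1)
qed

section \<open>The upper bound\<close>

text \<open>The real part of a full geometric sum of a \<open>q\<close>th root of unity, which is \<open>q\<close> or $0$.\<close>

lemma sum_cos_grid_nonneg:
  fixes m :: int and q :: nat
  assumes "q > 0"
  shows "(\<Sum>k<q. cos (2 * pi * m * k / q)) \<ge> 0"
proof -
  let ?z = "cis (2 * pi * m / q)"
  have "(\<Sum>k<q. cos (2 * pi * m * k / q)) = Re (\<Sum>k<q. ?z ^ k)"
    by (simp add: Complex.DeMoivre algebra_simps)
  moreover have "?z ^ q = 1"
    using assms by (simp add: Complex.DeMoivre)
  ultimately show ?thesis
    by (simp add: sum_gp_strict)
qed

lemma sum_cos_mult_cos_grid_nonneg:
  fixes n j q :: nat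
  assumes "q > 0"
  shows "(\<Sum>k<q. cos (2 * pi * real n * (k / q)) * cos (2 * pi * j * k / q)) \<ge> 0"
proof -
  have "cos (2 * pi * real n * (k / q)) * cos (2 * pi * j * k / q) =
     (cos (2 * pi * (int n - int j) * k / q) + cos (2 * pi * (int n + int j) * k / q)) / 2" for k :: nat
  proof -
    have "2 * pi * (int n - int j) * k / q = 2 * pi * real n * (k / q) - 2 * pi * j * k / q"
      "2 * pi * (int n + int j) * k / q = 2 * pi * real n * (k / q) + 2 * pi * j * k / q"
      by (simp_all add: algebra_simps diff_divide_distrib add_divide_distrib)
    then show ?thesis by (simp only: cos_times_cos)
  qed
  then have "(\<Sum>k<q. cos (2 * pi * real n * (k / q)) * cos (2 * pi * j * k / q)) =
      ((\<Sum>k<q. cos (2 * pi * (int n - int j) * k / q)) + (\<Sum>k<q. cos (2 * pi * (int n + int j) * k / q))) / 2"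
    by (simp only: sum_divide_distrib[symmetric] sum.distrib)
  then show ?thesis
    using sum_cos_grid_nonneg[OF assms, of "int n - int j"] sum_cos_grid_nonneg[OF assms, of "int n + int j"]
    by simp
qed

text \<open>Summing the series over the grid first leaves $\sum_n a_n s_n$ with nonnegative weights
  $s_n$; for $j = 0$ the weight of $a_0$ is \<open>q\<close>.\<close>

lemma cosine_coeffs_grid_sum:
  fixes j q :: nat
  assumes "cosine_coeffs f a" "q > 0"
  shows "(\<Sum>k<q. f (k / q) * cos (2 * pi * j * k / q)) \<ge> (if j = 0 then real q * a 0 else 0)"
proof -
  let ?s = "\<lambda>n. \<Sum>k<q. cos (2 * pi * real n * (k / q)) * cos (2 * pi * j * k / q)"
  have a: "\<And>n. a n \<ge> 0" and f: "\<And>x. (\<lambda>n. a n * cos (2 * pi * real n * x)) sums f x"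
    using assms(1) by (auto simp: cosine_coeffs_def)
  have "(\<lambda>n. \<Sum>k<q. a n * cos (2 * pi * real n * (k / q)) * cos (2 * pi * j * k / q)) sums
     (\<Sum>k<q. f (k / q) * cos (2 * pi * j * k / q))"
    by (intro sums_sum sums_mult2 f)
  then have S: "(\<lambda>n. a n * ?s n) sums (\<Sum>k<q. f (k / q) * cos (2 * pi * j * k / q))"
    by (simp add: sum_distrib_left mult.assoc)
  have "(\<Sum>n\<in>{0}. a n * ?s n) \<le> (\<Sum>n. a n * ?s n)"
    using S a sum_cos_mult_cos_grid_nonneg[OF assms(2)]
    by (intro sum_le_suminf mult_nonneg_nonneg) (auto simp: sums_iff)
  moreover have "a 0 * ?s 0 \<ge> (if j = 0 then real q * a 0 else 0)"
    using mult_nonneg_nonneg[OF a[of 0] sum_cos_mult_cos_grid_nonneg[OF assms(2), of 0 j]] by simp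
  ultimately show ?thesis using S by (simp add: sums_iff)
qed

lemma K_grid_sum:
  fixes j q :: nat
  assumes f: "f \<in> K (2 / q)" and q: "q \<ge> 4"
  shows "(\<Sum>k<q. f (k / q) * cos (2 * pi * j * k / q)) = 1 + 2 * f (1 / q) * cos (2 * pi * j / q)"
proof -
  let ?F = "\<lambda>k. f (real k / q) * cos (2 * pi * j * k / q)"
  have per: "\<And>x. f (x + 1) = f x" and even: "\<And>x. f (- x) = f x" and f0: "f 0 = 1"
    and zero: "\<And>x. 2 / q \<le> \<bar>x\<bar> \<and> \<bar>x\<bar> \<le> 1/2 \<Longrightarrow> f x = 0"
    using f by (auto simp: K_def)
  \<comment> \<open>The second half of the grid is the reflection of the first.\<close>
  have refl: "f (1 - x) = f x" for x using per[of "- x"] even[of x] by (simp add: add.commute)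
  have "f (real k / q) = 0" if "k \<in> {..<q} - {0, 1, q - 1}" for k
  proof (cases "2 * k \<le> q")
    case True
    then have "2 / q \<le> real k / q" "real k / q \<le> 1/2" using that q by (auto simp: field_simps)
    then show ?thesis using zero[of "real k / q"] by simp
  next
    case False
    then have "2 / q \<le> 1 - real k / q" "1 - real k / q \<le> 1/2" using that q by (auto simp: field_simps)
    then have "f (1 - real k / q) = 0" using zero[of "1 - real k / q"] abs_of_nonneg[of "1 - real k / q"]
      order_trans[of 0 "2 / real q" "1 - real k / q"] by (simp del: abs_of_nonneg abs_le_iff)
    then show ?thesis by (simp add: refl)
  qed
  then have "sum ?F {..<q} = sum ?F {0, 1, q - 1}"
    using q by (intro sum.mono_neutral_right) auto
  also have "\<dots> = 1 + f (1 / q) * cos (2 * pi * j / q) + f (real (q - 1) / q) * cos (2 * pi * j * real (q - 1) / q)"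
    using q f0 by simp
  also have "real (q - 1) / q = 1 - 1 / q" using q by (simp add: of_nat_diff field_simps)
  also have "2 * pi * j * real (q - 1) / q = 2 * j * pi - 2 * pi * j / q"
    using q by (simp add: of_nat_diff field_simps)
  finally show ?thesis by (simp add: refl cos_diff)
qed

text \<open>Frequency $j = (q - 1)/2$ bounds $f(1/q)$, since there the cosine is $-\cos(\pi/q)$;
  frequency $0$ then bounds $a_0$.\<close>

lemma K_coeff_0_le:
  fixes q :: nat
  assumes f: "f \<in> K (2 / q)" "cosine_coeffs f a" and q: "odd q" "q \<ge> 4"
  shows "a 0 \<le> (1 + cos (pi / q)) / (q * cos (pi / q))"
proof -
  define j where "j = (q - 1) div 2"
  have j: "2 * j = q - 1" "j \<noteq> 0" using q by (auto simp: j_def)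
  have c: "cos (pi / q) > 0" using q by (intro cos_pi_div_pos) simp
  have "2 * real j = real q - 1" using j(1) q by linarith
  then have "pi * (2 * real j) = pi * (real q - 1)" by simp
  then have "2 * pi * j / q = pi - pi / q" using q by (simp add: field_simps)
  then have "0 \<le> 1 - 2 * f (1 / q) * cos (pi / q)"
    using cosine_coeffs_grid_sum[OF f(2), of q j] K_grid_sum[OF f(1) q(2), of j] q j(2) by simp
  then have t: "2 * f (1 / q) \<le> 1 / cos (pi / q)" using c by (simp add: field_simps)
  have "q * a 0 \<le> 1 + 2 * f (1 / q)"
    using cosine_coeffs_grid_sum[OF f(2), of q 0] K_grid_sum[OF f(1) q(2), of 0] q by simp
  also note t
  finally show ?thesis using c q by (simp add: field_simps)
qed

theorem theorem3:
  fixes q :: nat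
  assumes "odd q" and "q \<ge> 5"
  shows "A (2 / real q) = (1 + cos (pi / real q)) / (real q * cos (pi / real q))"
proof -
  have q: "q \<ge> 4" using assms by simp
  have c: "cos (pi / q) > 0" using q by (intro cos_pi_div_pos) simp
  show ?thesis unfolding A_def
  proof (rule cSup_eq_maximum)
    have "extremal_coeff q 0 = (1 + cos (pi / q)) / (q * cos (pi / q))"
      using c q by (simp add: extremal_coeff_def tent_coeff_def field_simps)
    then show "(1 + cos (pi / q)) / (q * cos (pi / q)) \<in> {a 0 |f a. f \<in> K (2 / q) \<and> cosine_coeffs f a}"
      using extremal_fun_in_K[OF assms(1) q]
      by (intro CollectI exI[of _ "extremal_fun q"] exI[of _ "extremal_coeff q"]) simp
  qed (use K_coeff_0_le[OF _ _ assms(1) q] in blast)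
qed

end
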